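(* Let $M\ge 4$ be an even integer congruent to $1$ or $4$ modulo $5$. Then $$ \begin{aligned} 1&+q\frac{t}{1-tq}+\frac{q^4}{1-tq}\cdot\frac{[M/2]_{q^2}+(w-1)q^{M-4}}{1-wq^M}\\ &+\sum_{k=3}^{M-1}\frac{q^{k^2}}{(1-tq)\prod_{i=3}^{k}(1-q^{i})}\cdot\frac{[M/2]_{q^2}}{1-wq^M}\\ &+\sum_{k=M}^\infty\frac{q^{k^2}}{(1-tq)(1-wq^{M})\prod_{2\le i\le k,\ i\ne M}(1-q^i)}\\ &=\frac{1-q^{M}}{1-wq^{M}}\cdot\frac{1}{(1-tq)(1-q^4)}\prod_{k=1}^\infty\frac{1}{(1-q^{5k+1})(1-q^{5k+4})}. \end{aligned} $$
   Context: $[n]_{q^2}=1+q^2+q^4+\cdots+q^{2(n-1)}$ for a positive integer $n$. The identity is one of formal power series in $q$ with coefficients in $\mathbb{Z}[t,w]$. *)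

theory Defs
  imports
    "HOL-Computational_Algebra.Formal_Power_Series"
    "HOL-Computational_Algebra.Polynomial"
    "HOL-Analysis.Infinite_Products"
begin

text \<open>
  The ring of polynomials in the two indeterminates $t$, $w$ over the integers is
  \<^typ>\<open>int poly poly\<close>: the inner indeterminate is $t$, the outer one is $w$.
  Limits in \<^typ>\<open>int poly poly fps\<close> (infinite sums and products) refer to the
  $q$-adic metric of the library, in which two series are close iff they agree up to a high
  power of $q$.
\<close>

abbreviation qvar :: "int poly poly fps" where
  "qvar \<equiv> fps_X"

abbreviation tvar :: "int poly poly fps" where
  "tvar \<equiv> fps_const [:[:0, 1:]:]"

abbreviation wvar :: "int poly poly fps" where
  "wvar \<equiv> fps_const [:0, 1:]"

text \<open>
  The library's division of power series needs an inverse operation on the coefficients, which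
  \<^typ>\<open>int poly poly\<close> does not have. The quotient below is by a series with
  constant coefficient 1, which is a unit over every commutative ring. It is meaningless for other
  denominators.
\<close>

definition fps_quot :: "'a::comm_ring_1 fps \<Rightarrow> 'a fps \<Rightarrow> 'a fps"
    (infixl \<open>\<oslash>\<close> 70) where
  "f \<oslash> g = f * fps_right_inverse g 1"

lemma fps_quot_mult:
  assumes "fps_nth g 0 = 1"
  shows "(f \<oslash> g) * g = f"
proof -
  have "g * fps_right_inverse g 1 = 1"
    using assms by (intro fps_right_inverse) simp
  then show ?thesis
    unfolding fps_quot_def by (metis mult.assoc mult.commute mult_1_right)
qed

lemma fps_quot_unique:
  assumes "fps_nth g 0 = 1" and "h * g = f"
  shows "h = f \<oslash> g"
proof -
  have "g * fps_right_inverse g 1 = 1"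
    using assms(1) by (intro fps_right_inverse) simp
  then show ?thesis
    unfolding fps_quot_def using assms(2) by (metis mult.assoc mult_1_right)
qed

text \<open>\<open>qbracket n x\<close> is $[n]_x = 1 + x + \cdots + x^{n-1}$.\<close>

definition qbracket :: "nat \<Rightarrow> 'a::comm_ring_1 \<Rightarrow> 'a" where
  "qbracket n x = (\<Sum>i<n. x ^ i)"

end

theory Submission
  imports Defs
begin

text \<open>
  Since \<open>(1 - q\<^sup>2) [M/2] = 1 - q\<^sup>M\<close> for even \<open>M\<close>, multiplying by
  \<open>(1 - tq)(1 - wq\<^sup>M)\<close> turns the left-hand side into \<open>(1 - q\<^sup>M)(1 - q)\<close> times the sum of
  the first Rogers--Ramanujan identity, and \<open>t\<close> and \<open>w\<close> disappear.

  The Rogers--Ramanujan identity follows from Bailey's lemma: the triple product at \<open>z = 1\<close> says that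
  \<open>(-1)\<^sup>k q^(k choose 2) (1 + q\<^sup>k)\<close> forms a Bailey pair with the sequence \<open>1, 0, 0, \<dots>\<close>;
  applying the lemma twice gives a finite identity between the partial sum and a partial theta series
  in \<open>q\<^sup>5\<close>, which the triple product with base \<open>q\<^sup>5\<close> evaluates. All passages to the limit are
  congruences modulo a power of \<open>q\<close>.
\<close>

section \<open>Reciprocals of power series with constant term 1\<close>

lemma fps_quot_one_mult [simp]: "fps_nth g 0 = 1 \<Longrightarrow> (1 \<oslash> g) * g = 1"
  by (rule fps_quot_mult)

lemma fps_quot_one_mult' [simp]: "fps_nth g 0 = 1 \<Longrightarrow> g * (1 \<oslash> g) = 1"
  by (subst mult.commute) (rule fps_quot_one_mult)

lemma fps_quot_conv_mult: "f \<oslash> g = f * (1 \<oslash> g)"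
  by (simp add: fps_quot_def)

lemma fps_quot_one_one [simp]: "1 \<oslash> (1 :: 'a::comm_ring_1 fps) = 1"
  by (rule fps_quot_unique [symmetric]) auto

lemma fps_quot_one_mult_distrib:
  assumes "fps_nth g 0 = 1" "fps_nth h 0 = 1"
  shows "1 \<oslash> (g * h) = (1 \<oslash> g) * (1 \<oslash> h)"
proof -
  have "(1 \<oslash> g) * (1 \<oslash> h) * (g * h) = ((1 \<oslash> g) * g) * ((1 \<oslash> h) * h)"
    by (simp only: mult_ac)
  also have "\<dots> = 1" using assms by simp
  finally show ?thesis
    using assms by (intro fps_quot_unique [symmetric]) auto
qed

section \<open>Congruence modulo a power of the variable\<close>

definition fps_cong :: "nat \<Rightarrow> 'a::comm_ring_1 fps \<Rightarrow> 'a fps \<Rightarrow> bool" where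
  "fps_cong n f g \<longleftrightarrow> fps_X ^ n dvd f - g"

lemma fps_cong_refl [simp]: "fps_cong n f f"
  by (simp add: fps_cong_def)

lemma fps_cong_sym: "fps_cong n f g \<Longrightarrow> fps_cong n g f"
  unfolding fps_cong_def by (subst minus_diff_eq [symmetric]) (simp only: dvd_minus_iff)

lemma fps_cong_trans [trans]: "fps_cong n f g \<Longrightarrow> fps_cong n g h \<Longrightarrow> fps_cong n f h"
  unfolding fps_cong_def using dvd_add [of "fps_X ^ n" "f - g" "g - h"] by simp

lemma fps_cong_mult:
  assumes "fps_cong n f g" "fps_cong n h k"
  shows "fps_cong n (f * h) (g * k)"
proof -
  have "f * h - g * k = (f - g) * h + g * (h - k)"
    by (simp add: algebra_simps)
  then show ?thesis
    using assms unfolding fps_cong_def by simp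
qed

lemma fps_cong_mult_right: "fps_cong n g h \<Longrightarrow> fps_cong n (g * f) (h * f)"
  by (intro fps_cong_mult) auto

lemma fps_cong_mult_left: "fps_cong n g h \<Longrightarrow> fps_cong n (f * g) (f * h)"
  by (intro fps_cong_mult) auto

lemma fps_cong_add: "fps_cong n f g \<Longrightarrow> fps_cong n h k \<Longrightarrow> fps_cong n (f + h) (g + k)"
  unfolding fps_cong_def using dvd_add [of "fps_X ^ n" "f - g" "h - k"] by (simp add: algebra_simps)

lemma fps_cong_sum:
  assumes "\<And>x. x \<in> A \<Longrightarrow> fps_cong n (f x) (g x)"
  shows "fps_cong n (sum f A) (sum g A)"
  using assms
proof (induction A rule: infinite_finite_induct)
  case (insert x A)
  then show ?case using fps_cong_add [of n "f x" "g x" "sum f A" "sum g A"] by simp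
qed auto

lemma fps_cong_mono: "fps_cong n f g \<Longrightarrow> m \<le> n \<Longrightarrow> fps_cong m f g"
  unfolding fps_cong_def by (rule dvd_trans [OF le_imp_power_dvd])

lemma fps_cong_cancel:
  assumes "fps_cong n (f * h) (g * h)" "fps_nth h 0 = 1"
  shows "fps_cong n f g"
  using fps_cong_mult_right [OF assms(1), of "1 \<oslash> h"] assms(2)
  by (simp add: mult.assoc)

text \<open>A factor divisible by \<open>fps_X ^ m\<close> raises the precision by \<open>m\<close>.
  This offsets the weak congruences that occur for large summation indices in the theta
  series.\<close>

lemma fps_cong_dvd_mult:
  assumes "fps_X ^ m dvd h" "fps_cong n f g"
  shows "fps_cong (m + n) (h * f) (h * g)"
  using mult_dvd_mono [of "fps_X ^ m" h "fps_X ^ n" "f - g"] assms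
  by (simp add: fps_cong_def power_add right_diff_distrib)

text \<open>From 1/f - 1/g = (1/f)(1/g)(g - f).\<close>

lemma fps_cong_quot:
  assumes "fps_cong n f g" "fps_nth f 0 = 1" "fps_nth g 0 = 1"
  shows "fps_cong n (1 \<oslash> f) (1 \<oslash> g)"
proof -
  have "(1 \<oslash> f) * (1 \<oslash> g) * g = 1 \<oslash> f"
    by (simp only: mult.assoc fps_quot_one_mult [OF assms(3)] mult_1_right)
  moreover have "(1 \<oslash> f) * (1 \<oslash> g) * f = 1 \<oslash> g"
    by (simp only: mult.assoc mult.commute [of "1 \<oslash> g" f] fps_quot_one_mult [OF assms(2)] mult_1
      flip: mult.assoc [of "1 \<oslash> f" f])
  ultimately show ?thesis
    using fps_cong_mult_left [OF fps_cong_sym [OF assms(1)], of "(1 \<oslash> f) * (1 \<oslash> g)"]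
    by (simp only:)
qed

lemma fps_cong_nth:
  assumes "fps_cong n f g" "k < n"
  shows "fps_nth f k = fps_nth g k"
proof -
  obtain h where "f - g = fps_X ^ n * h"
    using assms(1) unfolding fps_cong_def by (rule dvdE)
  then have "fps_nth (f - g) k = fps_nth (fps_X ^ n * h) k" by simp
  then show ?thesis using assms(2) by (simp add: fps_X_power_mult_nth)
qed

section \<open>q-Pochhammer symbols\<close>

text \<open>The symbol (q;q)_n. The base is a parameter because both \<open>fps_X\<close> and
  \<open>fps_X ^ 5\<close> occur as bases.\<close>

definition fps_qpoch :: "'a::comm_ring_1 fps \<Rightarrow> nat \<Rightarrow> 'a fps" where
  "fps_qpoch q n = (\<Prod>i=1..n. 1 - q ^ i)"

definition fps_inv_qpoch :: "'a::comm_ring_1 fps \<Rightarrow> nat \<Rightarrow> 'a fps" where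
  "fps_inv_qpoch q n = 1 \<oslash> fps_qpoch q n"

lemma fps_qpoch_0 [simp]: "fps_qpoch q 0 = 1"
  by (simp add: fps_qpoch_def)

lemma fps_inv_qpoch_0 [simp]: "fps_inv_qpoch q 0 = 1"
  by (simp add: fps_inv_qpoch_def)

lemma fps_qpoch_Suc: "fps_qpoch q (Suc n) = fps_qpoch q n * (1 - q ^ Suc n)"
  by (simp add: fps_qpoch_def)

lemma fps_nth_prod_0: "fps_nth (prod f A) 0 = (\<Prod>x\<in>A. fps_nth (f x) 0)"
  by (induction A rule: infinite_finite_induct) auto

text \<open>The vanishing constant term makes every 1 - q^n with n > 0 a unit;
  \<open>q_nonzero\<close>, over an integral domain, allows powers of \<open>q\<close> to be
  cancelled.\<close>

locale fps_base =
  fixes q :: "'a::idom fps"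
  assumes q_nth_0 [simp]: "fps_nth q 0 = 0" and q_nonzero: "q \<noteq> 0"
begin

abbreviation Q where "Q \<equiv> fps_qpoch q"
abbreviation I where "I \<equiv> fps_inv_qpoch q"

lemma q_power_nth_0 [simp]: "n > 0 \<Longrightarrow> fps_nth (q ^ n) 0 = 0"
  by (simp add: fps_nth_power_0)

lemma qpoch_nth_0 [simp]: "fps_nth (Q n) 0 = 1"
  by (simp add: fps_qpoch_def fps_nth_prod_0)

lemma inv_qpoch_mult [simp]: "I n * Q n = 1" "Q n * I n = 1"
  by (simp_all add: fps_inv_qpoch_def)

lemma one_minus_q_power_nonzero: "1 - q ^ Suc n \<noteq> 0"
proof
  assume "1 - q ^ Suc n = 0"
  then have "fps_nth (1 - q ^ Suc n) 0 = 0" by simp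
  then show False by (simp del: power_Suc)
qed

lemma inv_qpoch_Suc: "(1 - q ^ Suc n) * I (Suc n) = I n"
proof -
  have "(1 - q ^ Suc n) * I (Suc n) = I n * Q n * ((1 - q ^ Suc n) * I (Suc n))"
    by simp
  also have "\<dots> = I n * (Q (Suc n) * I (Suc n))"
    by (simp only: fps_qpoch_Suc mult_ac)
  finally show ?thesis by simp
qed

lemma X_power_dvd_q_power: "fps_X ^ n dvd q ^ n"
proof -
  have "q = fps_X * fps_shift 1 q"
    by (simp add: fps_eq_iff)
  then have "fps_X dvd q" by (rule dvdI)
  then show ?thesis by (rule dvd_power_same)
qed

text \<open>The additional factors 1 - q^i have i > n and are therefore 1 modulo
  \<open>fps_X ^ Suc n\<close>.\<close>

lemma qpoch_cong_less: "fps_cong (Suc n) (Q (n + d)) (Q n)"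
proof (induction d)
  case (Suc d)
  have "fps_X ^ Suc n dvd q ^ Suc (n + d)"
    by (rule dvd_trans [OF X_power_dvd_q_power]) (simp add: le_imp_power_dvd)
  then have "fps_cong (Suc n) (1 - q ^ Suc (n + d)) 1"
    unfolding fps_cong_def by (simp add: dvd_minus_iff del: power_Suc)
  with Suc show ?case
    using fps_cong_mult [of "Suc n" "Q (n + d)" "Q n" "1 - q ^ Suc (n + d)" 1]
    by (simp add: fps_qpoch_Suc del: power_Suc)
qed simp

lemma qpoch_cong:
  assumes "n \<le> a" "n \<le> b"
  shows "fps_cong (Suc n) (Q a) (Q b)"
  using qpoch_cong_less [of n "a - n"] qpoch_cong_less [of n "b - n"] assms
  by (auto intro: fps_cong_trans fps_cong_sym)

lemma qpoch_inv_qpoch_cong: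
  assumes "n \<le> a" "n \<le> b"
  shows "fps_cong (Suc n) (Q a * I b) 1"
  using fps_cong_mult_right [OF qpoch_cong [OF assms], of "I b"] by simp

section \<open>The finite q-binomial theorem and the finite triple product\<close>

text \<open>The finite q-binomial theorem, with Gaussian binomials written as
  \<open>Q n * I k * I (n - k)\<close>. Its homogeneous form in \<open>y\<close> needs no negative
  powers.\<close>

lemma rothe:
  "(\<Prod>i<n. y - q ^ i) = Q n * (\<Sum>k\<le>n. (-1) ^ k * q ^ (k choose 2) * y ^ (n - k) * I k * I (n - k))"
proof (induction n)
  case (Suc n)
  define R where "R n = (\<Sum>k\<le>n. (-1) ^ k * q ^ (k choose 2) * y ^ (n - k) * I k * I (n - k))" for n
  define c where "c m k = (-1) ^ k * q ^ (k choose 2) * y ^ (m - k)" for m k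
  \<comment> \<open>The q-Pascal rule: 1 - q^(n+1) = (1 - q^(n+1-k)) + q^(n+1-k) (1 - q^k). Each
    part lowers the index of one of the two reciprocal symbols and vanishes at one end of the
    range.\<close>
  have "(1 - q ^ Suc n) * R (Suc n) =
      (\<Sum>k\<le>Suc n. c (Suc n) k * I k * ((1 - q ^ (Suc n - k)) * I (Suc n - k))) +
      (\<Sum>k\<le>Suc n. c (Suc n) k * q ^ (Suc n - k) * ((1 - q ^ k) * I k) * I (Suc n - k))"
    unfolding R_def sum.distrib [symmetric] sum_distrib_left
  proof (rule sum.cong, goal_cases)
    case (2 k)
    then have "q ^ Suc n = q ^ (Suc n - k) * q ^ k"
      by (simp flip: power_add del: power_Suc)
    then show ?case
      unfolding c_def by (simp only:) (simp only: ring_distribs mult_ac, simp add: algebra_simps)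
  qed simp
  also have "(\<Sum>k\<le>Suc n. c (Suc n) k * I k * ((1 - q ^ (Suc n - k)) * I (Suc n - k))) =
      (\<Sum>k\<le>n. c (Suc n) k * I k * I (n - k))"
    by (simp add: Suc_diff_le inv_qpoch_Suc del: power_Suc)
  also have "\<dots> = y * R n"
    unfolding R_def c_def sum_distrib_left
    by (intro sum.cong) (simp_all add: Suc_diff_le)
  also have "(\<Sum>k\<le>Suc n. c (Suc n) k * q ^ (Suc n - k) * ((1 - q ^ k) * I k) * I (Suc n - k)) =
      (\<Sum>k\<le>n. c (Suc n) (Suc k) * q ^ (n - k) * I k * I (n - k))"
    by (subst sum.atMost_Suc_shift) (simp add: inv_qpoch_Suc del: power_Suc)
  also have "\<dots> = - (q ^ n * R n)"
    unfolding R_def sum_distrib_left sum_negf [symmetric]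
  proof (rule sum.cong, goal_cases)
    case (2 k)
    then have "q ^ n = q ^ k * q ^ (n - k)"
      by (simp flip: power_add)
    moreover have "(Suc k choose 2) = k + (k choose 2)"
      by (simp add: numeral_2_eq_2)
    ultimately show ?case
      unfolding c_def by (simp add: power_add)
  qed simp
  finally have "(1 - q ^ Suc n) * R (Suc n) = (y - q ^ n) * R n"
    by (simp add: algebra_simps)
  then show ?case
    using Suc unfolding R_def [symmetric] fps_qpoch_Suc
    by (simp add: mult_ac)
qed (simp add: numeral_2_eq_2)

text \<open>The one-sided form of the triple product: the indices \<open>k\<close> and \<open>-k\<close> are paired, which keeps
  all exponents natural.\<close>

definition theta_coeff :: "'a fps \<Rightarrow> 'a fps \<Rightarrow> nat \<Rightarrow> 'a fps" where
  "theta_coeff z z' k = (if k = 0 then 1 else (-1) ^ k * q ^ (k choose 2) * (z ^ k + z' ^ k))"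

lemma choose_2_add: "(m + n choose 2) = (m choose 2) + (n choose 2) + m * n"
  by (induction n) (simp_all add: numeral_2_eq_2)

text \<open>Rothe's formula with 2s factors, re-centred at the middle index s: the terms s + k and s
  - k yield the powers of \<open>z\<close> and \<open>z'\<close>. Here \<open>z'\<close> stands for
  q/z, so that \<open>z\<close> need not be invertible.\<close>

lemma finite_triple_product:
  assumes "z * z' = q"
  shows "(\<Sum>k\<le>s. theta_coeff z z' k * I (s - k) * I (s + k)) =
    I (2 * s) * (\<Prod>i<s. (1 - z * q ^ i) * (1 - z' * q ^ i))"
proof (cases s)
  case 0
  then show ?thesis by (simp add: theta_coeff_def)
next
  case (Suc r)
  \<comment> \<open>As r = s - 1, this gives y z = q^s. Hence y - q^(s+i) = y (1 - z q^i) for the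
    upper half of the product, while the lower half produces the factors in
    \<open>z'\<close>.\<close>
  define y where "y = q ^ r * z'"
  have yz: "y * z = q ^ s"
    using assms by (simp add: y_def Suc mult_ac)
  have [simp]: "q \<noteq> 0" by (rule q_nonzero)
  have "y \<noteq> 0" using yz by auto
  \<comment> \<open>The coefficient of the middle term k = s of Rothe's sum. It also splits off the
    product and, being nonzero, is cancelled at the end.\<close>
  define C where "C = (-1) ^ s * q ^ (s choose 2) * y ^ s"
  have "C \<noteq> 0" using \<open>y \<noteq> 0\<close> by (simp add: C_def)
  define t where "t k = (-1) ^ k * q ^ (k choose 2) * y ^ (2 * s - k) * I k * I (2 * s - k)" for k
  have up: "t (s + k) = C * ((-1) ^ k * q ^ (k choose 2) * z ^ k * I (s - k) * I (s + k))"
    if "k \<le> s" for k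
  proof -
    \<comment> \<open>Since q^s = y z, the factor q^(sk) supplies the k missing powers of
      \<open>y\<close>.\<close>
    have "q ^ (s * k) * y ^ (s - k) = y ^ s * z ^ k"
      using that by (simp add: power_mult flip: yz)
        (simp add: power_mult_distrib mult_ac flip: power_add)
    then have "q ^ ((s + k) choose 2) * y ^ (s - k) = q ^ (s choose 2) * y ^ s * q ^ (k choose 2) * z ^ k"
      by (simp add: choose_2_add power_add mult_ac)
    moreover have "2 * s - (s + k) = s - k" by simp
    ultimately show ?thesis
      unfolding t_def C_def by (simp add: power_add mult_ac)
  qed
  have down: "t (s - k) = C * ((-1) ^ k * q ^ (k choose 2) * z' ^ k * I (s - k) * I (s + k))"
    if "k \<le> s" for k
  proof -
    have 1: "s choose 2 = (s - k choose 2) + (k choose 2) + (s - k) * k"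
      using choose_2_add [of "s - k" k] that by simp
    have 2: "s * k = (s - k) * k + 2 * (k choose 2) + k"
    proof -
      have "2 * (k choose 2) + k = k * k"
        by (cases k) (simp_all add: choose_two)
      moreover have "s * k = (s - k) * k + k * k"
        using that by (simp flip: add_mult_distrib)
      ultimately show ?thesis by simp
    qed
    \<comment> \<open>The extra factor q^k turns the exponent (s - 1) k into s k, which splits by
      \<open>2\<close>; it is cancelled afterwards.\<close>
    have "q ^ k * y ^ k = q ^ (s * k) * z' ^ k"
      unfolding y_def by (simp add: Suc power_mult_distrib power_add power_mult [of q r k])
    also have "\<dots> = q ^ k * (q ^ ((s - k) * k + 2 * (k choose 2)) * z' ^ k)"
      unfolding 2 by (simp only: power_add mult_ac)
    finally have "y ^ k = q ^ ((s - k) * k + 2 * (k choose 2)) * z' ^ k"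
      by simp
    then have "q ^ (s - k choose 2) * y ^ k = q ^ (s choose 2) * q ^ (k choose 2) * z' ^ k"
      by (simp add: 1 power_add mult_ac mult_2)
    moreover have "y ^ (2 * s - (s - k)) = y ^ s * y ^ k"
      using that by (simp flip: power_add)
    moreover have "2 * s - (s - k) = s + k" using that by simp
    moreover have "(-1 :: 'a fps) ^ (s - k) = (-1) ^ s * (-1) ^ k"
      using that by (auto simp: minus_one_power_iff)
    ultimately show ?thesis
      unfolding t_def C_def by (simp add: mult_ac)
  qed
  have "(\<Sum>k\<le>2 * s. t k) = (\<Sum>k<s. t k) + (\<Sum>k=s..2 * s. t k)"
    by (subst sum.union_disjoint [symmetric]) (auto intro!: sum.cong)
  also have "(\<Sum>k=s..2 * s. t k) = (\<Sum>k\<le>s. t (s + k))"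
    by (rule sum.reindex_bij_witness [where i = "\<lambda>k. s + k" and j = "\<lambda>k. k - s"]) auto
  also have "(\<Sum>k<s. t k) = (\<Sum>k=1..s. t (s - k))"
    by (rule sum.reindex_bij_witness [where i = "\<lambda>k. s - k" and j = "\<lambda>k. s - k"]) auto
  also have "(\<Sum>k\<le>s. t (s + k)) = t s + (\<Sum>k=1..s. t (s + k))"
    by (simp add: atMost_atLeast0 sum.atLeast_Suc_atMost)
  also have "(\<Sum>k=1..s. t (s - k)) + (t s + (\<Sum>k=1..s. t (s + k))) =
      t s + (\<Sum>k=1..s. t (s + k) + t (s - k))"
    by (simp add: sum.distrib)
  also have "(\<Sum>k=1..s. t (s + k) + t (s - k)) =
      C * (\<Sum>k=1..s. theta_coeff z z' k * I (s - k) * I (s + k))"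
    unfolding sum_distrib_left
    by (intro sum.cong refl) (simp add: up down theta_coeff_def, simp add: algebra_simps)
  also have "t s + \<dots> = C * (\<Sum>k\<le>s. theta_coeff z z' k * I (s - k) * I (s + k))"
    using up [of 0]
    by (simp add: atMost_atLeast0 sum.atLeast_Suc_atMost theta_coeff_def numeral_2_eq_2 algebra_simps)
  finally have sum_t: "(\<Sum>k\<le>2 * s. t k) = \<dots>" .
  have "(\<Prod>i<2 * s. y - q ^ i) = (\<Prod>i<s. y - q ^ i) * (\<Prod>i=s..<2 * s. y - q ^ i)"
    by (subst prod.union_disjoint [symmetric]) (auto intro!: prod.cong)
  also have "(\<Prod>i=s..<2 * s. y - q ^ i) = (\<Prod>i<s. y - q ^ (s + i))"
    by (rule prod.reindex_bij_witness [where i = "\<lambda>k. s + k" and j = "\<lambda>k. k - s"]) auto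
  also have "\<dots> = (\<Prod>i<s. y * (1 - z * q ^ i))"
    by (simp add: power_add algebra_simps flip: yz)
  also have "\<dots> = y ^ s * (\<Prod>i<s. 1 - z * q ^ i)"
    by (simp add: prod.distrib)
  \<comment> \<open>Extracting -q^i leaves the exponents r - i; reversing the order of the factors
    then gives the product in \<open>z'\<close>.\<close>
  also have "(\<Prod>i<s. y - q ^ i) = (\<Prod>i<s. (- (q ^ i)) * (1 - z' * q ^ (r - i)))"
  proof (rule prod.cong, goal_cases)
    case (2 i)
    then have "q ^ r = q ^ i * q ^ (r - i)"
      using Suc by (simp flip: power_add)
    then show ?case by (simp add: y_def algebra_simps)
  qed simp
  also have "\<dots> = (\<Prod>i<s. - (q ^ i)) * (\<Prod>i<s. 1 - z' * q ^ (r - i))"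
    by (rule prod.distrib)
  also have "(\<Prod>i<s. 1 - z' * q ^ (r - i)) = (\<Prod>i<s. 1 - z' * q ^ i)"
    by (rule prod.reindex_bij_witness [where i = "\<lambda>k. r - k" and j = "\<lambda>k. r - k"]) (auto simp: Suc)
  also have "(\<Prod>i<s. - (q ^ i)) = (-1) ^ s * q ^ (s choose 2)"
    by (induction s) (simp_all add: power_add numeral_2_eq_2)
  finally have prod_eq: "(\<Prod>i<2 * s. y - q ^ i) = C * (\<Prod>i<s. (1 - z * q ^ i) * (1 - z' * q ^ i))"
    by (simp add: C_def prod.distrib mult_ac)
  have "I (2 * s) * (\<Prod>i<2 * s. y - q ^ i) = I (2 * s) * Q (2 * s) * (\<Sum>k\<le>2 * s. t k)"
    unfolding rothe [of y] t_def by (simp only: mult_ac)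
  then have "C * (I (2 * s) * (\<Prod>i<s. (1 - z * q ^ i) * (1 - z' * q ^ i))) =
      C * (\<Sum>k\<le>s. theta_coeff z z' k * I (s - k) * I (s + k))"
    unfolding prod_eq sum_t inv_qpoch_mult by (simp only: mult_ac mult_1)
  with \<open>C \<noteq> 0\<close> show ?thesis by simp
qed

section \<open>Bailey's lemma\<close>

text \<open>The q-Vandermonde sum in the limit where one upper parameter tends to infinity. The
  induction step passes from \<open>c\<close> to c + 1, so \<open>c\<close> must stay
  arbitrary.\<close>

lemma inv_qpoch_vandermonde:
  "(\<Sum>r\<le>n. q ^ (r * (r + c)) * I (n - r) * I r * I (r + c)) = I n * I (n + c)"
proof (induction n arbitrary: c)
  case (Suc n)
  \<comment> \<open>Split 1 - q^(n+1) = (1 - q^r) + q^r (1 - q^(n+1-r)). After a shift in the first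
    sum and expansion of \<open>I (r + c)\<close> in the second, the two merge into the sum for n
    and c + 1.\<close>
  have "(1 - q ^ Suc n) * (\<Sum>r\<le>Suc n. q ^ (r * (r + c)) * I (Suc n - r) * I r * I (r + c)) =
      (\<Sum>r\<le>Suc n. q ^ (r * (r + c)) * I (Suc n - r) * ((1 - q ^ r) * I r) * I (r + c)) +
      (\<Sum>r\<le>Suc n. q ^ (r * (r + c) + r) * ((1 - q ^ (Suc n - r)) * I (Suc n - r)) * I r * I (r + c))"
    unfolding sum.distrib [symmetric] sum_distrib_left
  proof (rule sum.cong, goal_cases)
    case (2 r)
    then have "q ^ Suc n = q ^ (Suc n - r) * q ^ r"
      by (simp flip: power_add del: power_Suc)
    then show ?case
      by (simp only: power_add) (simp only: ring_distribs mult_ac, simp add: algebra_simps)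
  qed simp
  also have "(\<Sum>r\<le>Suc n. q ^ (r * (r + c)) * I (Suc n - r) * ((1 - q ^ r) * I r) * I (r + c)) =
      (\<Sum>r\<le>n. q ^ (Suc r * (Suc r + c)) * I (n - r) * I r * I (Suc r + c))"
    by (subst sum.atMost_Suc_shift) (simp add: inv_qpoch_Suc del: power_Suc mult_Suc)
  also have "(\<Sum>r\<le>Suc n. q ^ (r * (r + c) + r) * ((1 - q ^ (Suc n - r)) * I (Suc n - r)) * I r * I (r + c)) =
      (\<Sum>r\<le>n. q ^ (r * (r + c) + r) * I (n - r) * I r * ((1 - q ^ Suc (r + c)) * I (Suc (r + c))))"
    by (simp add: inv_qpoch_Suc Suc_diff_le del: power_Suc)
  also have "(\<Sum>r\<le>n. q ^ (Suc r * (Suc r + c)) * I (n - r) * I r * I (Suc r + c)) + \<dots> =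
      (\<Sum>r\<le>n. q ^ (r * (r + Suc c)) * I (n - r) * I r * I (r + Suc c))"
    unfolding sum.distrib [symmetric]
  proof (rule sum.cong, goal_cases)
    case (2 r)
    have "Suc r * (Suc r + c) = r * (r + c) + r + Suc (r + c)" by simp
    moreover have "r * (r + Suc c) = r * (r + c) + r" by simp
    ultimately show ?case
      by (simp only: power_add) (simp add: algebra_simps)
  qed simp
  also have "\<dots> = I n * I (n + Suc c)" by (rule Suc.IH)
  also have "\<dots> = (1 - q ^ Suc n) * (I (Suc n) * I (Suc n + c))"
    by (simp only: inv_qpoch_Suc mult.assoc [symmetric]) simp
  finally show ?case
    using one_minus_q_power_nonzero [of n] by (simp add: mult_cancel_left del: power_Suc sum.atMost_Suc)
qed simp

text \<open>Bailey's lemma relative to 1 with both free parameters sent to infinity. After the sums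
  are interchanged, s = k + r gives s^2 = k^2 + r(r + 2k), so the inner sum is the Vandermonde sum
  with c = 2k.\<close>

lemma bailey_lemma:
  "(\<Sum>s\<le>N. q ^ (s\<^sup>2) * I (N - s) * (\<Sum>k\<le>s. a k * I (s - k) * I (s + k))) =
   (\<Sum>k\<le>N. a k * q ^ (k\<^sup>2) * I (N - k) * I (N + k))"
proof -
  have "(\<Sum>s\<le>N. q ^ (s\<^sup>2) * I (N - s) * (\<Sum>k\<le>s. a k * I (s - k) * I (s + k))) =
      (\<Sum>s\<le>N. \<Sum>k\<le>s. a k * (q ^ (s\<^sup>2) * I (N - s) * I (s - k) * I (s + k)))"
    by (simp add: sum_distrib_left mult_ac)
  also have "\<dots> = (\<Sum>k\<le>N. \<Sum>s=k..N. a k * (q ^ (s\<^sup>2) * I (N - s) * I (s - k) * I (s + k)))"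
    unfolding sum.Sigma [OF finite_atMost ballI [OF finite_atMost]]
      sum.Sigma [OF finite_atMost ballI [OF finite_atLeastAtMost]]
    by (rule sum.reindex_bij_witness [where i = prod.swap and j = prod.swap]) auto
  also have "\<dots> = (\<Sum>k\<le>N. a k * q ^ (k\<^sup>2) * I (N - k) * I (N + k))"
  proof (rule sum.cong, goal_cases)
    case (2 k)
    then have "k \<le> N" by simp
    have "(\<Sum>s=k..N. q ^ (s\<^sup>2) * I (N - s) * I (s - k) * I (s + k)) =
        (\<Sum>r\<le>N - k. q ^ (k\<^sup>2) * (q ^ (r * (r + 2 * k)) * I (N - k - r) * I r * I (r + 2 * k)))"
    proof (rule sum.reindex_bij_witness [where i = "\<lambda>r. r + k" and j = "\<lambda>s. s - k"], goal_cases)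
      case (5 s)
      then obtain r where s: "s = k + r" using le_Suc_ex by auto
      have "s\<^sup>2 = k\<^sup>2 + r * (r + 2 * k)"
        by (simp add: s power2_eq_square algebra_simps)
      moreover have "s + k = r + 2 * k" "N - s = N - k - r" "s - k = r"
        by (simp_all add: s)
      ultimately show ?case by (simp only: power_add mult_ac)
    qed (use \<open>k \<le> N\<close> in auto)
    also have "\<dots> = q ^ (k\<^sup>2) * (I (N - k) * I (N - k + 2 * k))"
      by (simp only: inv_qpoch_vandermonde flip: sum_distrib_left)
    also have "N - k + 2 * k = N + k" using \<open>k \<le> N\<close> by simp
    finally show ?case
      by (simp add: mult_ac flip: sum_distrib_left)
  qed simp
  finally show ?thesis .
qed

section \<open>From finite identities to theta series\<close>

text \<open>\<open>Q N * I (N - k)\<close> is known to be 1 only modulo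
  \<open>fps_X ^ Suc (N - k)\<close>; the missing k powers come from \<open>a k\<close>.\<close>

lemma theta_cong:
  assumes "\<And>k. fps_X ^ k dvd a k"
  shows "fps_cong N (Q N * (Q N * (\<Sum>k\<le>N. a k * I (N - k) * I (N + k)))) (\<Sum>k\<le>N. a k)"
proof -
  have "Q N * (Q N * (\<Sum>k\<le>N. a k * I (N - k) * I (N + k))) =
      (\<Sum>k\<le>N. a k * ((Q N * I (N - k)) * (Q N * I (N + k))))"
    by (simp add: sum_distrib_left mult_ac)
  also have "fps_cong N \<dots> (\<Sum>k\<le>N. a k)"
  proof (rule fps_cong_sum)
    fix k assume "k \<in> {..N}"
    then have k: "k \<le> N" by simp
    have "fps_cong (Suc (N - k)) ((Q N * I (N - k)) * (Q N * I (N + k))) (1 * 1)"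
      using k by (intro fps_cong_mult qpoch_inv_qpoch_cong) auto
    from fps_cong_dvd_mult [OF assms [of k] this]
    show "fps_cong N (a k * ((Q N * I (N - k)) * (Q N * I (N + k)))) (a k)"
      using k by (auto elim: fps_cong_mono)
  qed
  finally show ?thesis .
qed

text \<open>One of the two factors \<open>Q N\<close> in \<open>theta_cong\<close> is absorbed by
  the \<open>I (2 * N)\<close> of the finite triple product, the other remains.\<close>

lemma triple_product_cong:
  assumes "z * z' = q" "\<And>k. fps_X ^ k dvd theta_coeff z z' k"
  shows "fps_cong N (Q N * (\<Prod>i<N. (1 - z * q ^ i) * (1 - z' * q ^ i)))
    (\<Sum>k\<le>N. theta_coeff z z' k)"
proof -
  let ?P = "\<Prod>i<N. (1 - z * q ^ i) * (1 - z' * q ^ i)"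
  have "fps_cong (Suc N) (Q N * I (2 * N)) 1"
    by (intro qpoch_inv_qpoch_cong) auto
  then have "fps_cong N (Q N * I (2 * N)) 1"
    by (rule fps_cong_mono) simp
  from fps_cong_sym [OF fps_cong_mult_right [OF this, of "Q N * ?P"]]
  have "fps_cong N (Q N * ?P) (Q N * (Q N * (I (2 * N) * ?P)))"
    by (simp add: mult_ac)
  also have "fps_cong N \<dots> (\<Sum>k\<le>N. theta_coeff z z' k)"
    using theta_cong [of "theta_coeff z z'" N] assms by (simp add: finite_triple_product)
  finally show ?thesis .
qed

lemma finite_rogers_ramanujan:
  "(\<Sum>s\<le>N. q ^ (s\<^sup>2) * I (N - s) * I s) =
   (\<Sum>k\<le>N. theta_coeff 1 q k * q ^ (2 * k\<^sup>2) * I (N - k) * I (N + k))"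
proof -
  \<comment> \<open>For s > 0 the triple product at z = 1 contains the factor 1 - q^0 = 0.\<close>
  have 0: "(\<Sum>k\<le>s. theta_coeff 1 q k * I (s - k) * I (s + k)) = (if s = 0 then 1 else 0)" for s
  proof (cases s)
    case (Suc r)
    have "(\<Prod>i<Suc r. (1 - 1 * q ^ i) * (1 - q * q ^ i)) = 0"
      by (rule prod_zero) (auto intro!: bexI [of _ 0])
    then show ?thesis
      using finite_triple_product [of 1 q "Suc r"] by (simp only: Suc mult_1 mult_zero_right) simp
  qed (simp add: theta_coeff_def)
  \<comment> \<open>First application of Bailey's lemma: only s = 0 contributes to its left-hand
    side.\<close>
  have 1: "(\<Sum>k\<le>s. theta_coeff 1 q k * q ^ (k\<^sup>2) * I (s - k) * I (s + k)) = I s" for s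
    using bailey_lemma [of s "theta_coeff 1 q"]
    by (simp add: 0 if_distrib sum.delta cong: if_cong)
  show ?thesis
    using bailey_lemma [of N "\<lambda>k. theta_coeff 1 q k * q ^ (k\<^sup>2)"]
    unfolding 1 by (simp add: mult.assoc mult_2 power_add)
qed

text \<open>The finite identity is multiplied by \<open>Q N\<close> twice; on the sum side one
  factor cancels \<open>I (N - s)\<close>, with the lost precision restored by q^(s^2).\<close>

lemma rogers_ramanujan_theta_cong:
  assumes "\<And>k. fps_X ^ k dvd theta_coeff 1 q k * q ^ (2 * k\<^sup>2)"
  shows "fps_cong N (Q N * (\<Sum>s\<le>N. q ^ (s\<^sup>2) * I s)) (\<Sum>k\<le>N. theta_coeff 1 q k * q ^ (2 * k\<^sup>2))"
proof -
  have "fps_cong N (\<Sum>s\<le>N. q ^ (s\<^sup>2) * I s * (Q N * I (N - s))) (\<Sum>s\<le>N. q ^ (s\<^sup>2) * I s * 1)"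
  proof (rule fps_cong_sum)
    fix s assume "s \<in> {..N}"
    have "fps_X ^ s dvd q ^ (s\<^sup>2) * I s"
      by (intro dvd_mult2 dvd_trans [OF X_power_dvd_q_power] le_imp_power_dvd)
        (simp add: power2_eq_square)
    moreover have "fps_cong (Suc (N - s)) (Q N * I (N - s)) 1"
      by (rule qpoch_inv_qpoch_cong) auto
    ultimately show "fps_cong N (q ^ (s\<^sup>2) * I s * (Q N * I (N - s))) (q ^ (s\<^sup>2) * I s * 1)"
      by (rule fps_cong_mono [OF fps_cong_dvd_mult]) (use \<open>s \<in> {..N}\<close> in auto)
  qed
  from fps_cong_mult_left [OF fps_cong_sym [OF this], of "Q N"]
  have "fps_cong N (Q N * (\<Sum>s\<le>N. q ^ (s\<^sup>2) * I s))
      (Q N * (Q N * (\<Sum>s\<le>N. q ^ (s\<^sup>2) * I (N - s) * I s)))"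
    by (simp add: sum_distrib_left mult_ac)
  also have "fps_cong N \<dots> (\<Sum>k\<le>N. theta_coeff 1 q k * q ^ (2 * k\<^sup>2))"
    unfolding finite_rogers_ramanujan by (rule theta_cong [OF assms])
  finally show ?thesis .
qed

end

section \<open>The product side: triple product with base q^5\<close>

text \<open>The three products cover the exponents congruent to 0, to 2 and 3, and to 1 and 4 modulo
  5, hence all of 1, ..., 5N.\<close>

lemma fps_qpoch_X5:
  "fps_qpoch (fps_X ^ 5) N * (\<Prod>i<N. (1 - fps_X ^ 2 * (fps_X ^ 5) ^ i) * (1 - fps_X ^ 3 * (fps_X ^ 5) ^ i)) *
     (\<Prod>i<N. (1 - fps_X ^ (5 * i + 1)) * (1 - fps_X ^ (5 * i + 4))) =
   fps_qpoch (fps_X :: 'a::comm_ring_1 fps) (5 * N)"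
proof (induction N)
  case (Suc N)
  have "5 * Suc N = Suc (Suc (Suc (Suc (Suc (5 * N)))))" by simp
  then have "fps_qpoch (fps_X :: 'a fps) (5 * Suc N) = fps_qpoch fps_X (5 * N) *
      ((1 - fps_X ^ (5 * N + 1)) * (1 - fps_X ^ (5 * N + 2)) * (1 - fps_X ^ (5 * N + 3)) *
       (1 - fps_X ^ (5 * N + 4)) * (1 - fps_X ^ (5 * N + 5)))"
    by (simp only: fps_qpoch_Suc mult.assoc) (simp add: eval_nat_numeral)
  moreover have "(fps_X ^ 5 :: 'a fps) ^ Suc N = fps_X ^ (5 * N + 5)"
    "fps_X ^ 2 * (fps_X ^ 5 :: 'a fps) ^ N = fps_X ^ (5 * N + 2)"
    "fps_X ^ 3 * (fps_X ^ 5 :: 'a fps) ^ N = fps_X ^ (5 * N + 3)"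
    by (simp_all only: power_mult [symmetric] power_add [symmetric]) (simp_all add: add_ac)
  ultimately show ?case
    unfolding Suc.IH [symmetric] fps_qpoch_Suc prod.lessThan_Suc by (simp only: mult_ac)
qed simp

interpretation X: fps_base "fps_X :: 'a::idom fps"
  by unfold_locales auto

interpretation X5: fps_base "fps_X ^ 5 :: 'a::idom fps"
  by unfold_locales (auto simp: fps_nth_power_0)

text \<open>Both sides carry the exponents k(5k - 1)/2 and k(5k + 1)/2. This identifies the theta
  series from Bailey's lemma with that of the triple product in base q^5.\<close>

lemma theta_coeff_X5:
  "X5.theta_coeff (fps_X ^ 2) (fps_X ^ 3) k =
   X.theta_coeff 1 (fps_X :: 'a::idom fps) k * fps_X ^ (2 * k\<^sup>2)"
proof (cases "k = 0")
  case False
  have *: "5 * (k choose 2) + 2 * k = (k choose 2) + 2 * k\<^sup>2"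
  proof -
    have "2 * (k choose 2) + k = k\<^sup>2"
      by (induction k) (simp_all add: power2_eq_square numeral_2_eq_2)
    then show ?thesis by simp
  qed
  have "(fps_X ^ 5 :: 'a fps) ^ (k choose 2) * ((fps_X ^ 2) ^ k + (fps_X ^ 3) ^ k) =
      fps_X ^ (5 * (k choose 2) + 2 * k) * (1 + fps_X ^ k)"
  proof -
    have "(fps_X :: 'a fps) ^ (3 * k) = fps_X ^ (2 * k) * fps_X ^ k"
      by (simp flip: power_add)
    then show ?thesis
      by (simp only: power_add power_mult [symmetric]) (simp add: algebra_simps)
  qed
  also have "\<dots> = fps_X ^ (k choose 2) * (1 + fps_X ^ k) * fps_X ^ (2 * k\<^sup>2)"
    unfolding * by (simp add: power_add mult_ac)
  finally show ?thesis
    using False by (simp add: X.theta_coeff_def X5.theta_coeff_def mult.assoc)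
qed (simp add: X.theta_coeff_def X5.theta_coeff_def)

text \<open>Multiplied by \<open>?R\<close>, the triple product \<open>?T\<close> becomes
  (q;q)_(5N), which agrees with (q;q)_N to the required order; the latter is a unit and
  cancels.\<close>

lemma rogers_ramanujan_cong:
  "fps_cong N ((\<Sum>s\<le>N. fps_X ^ (s\<^sup>2) * fps_inv_qpoch fps_X s) *
    (\<Prod>i<N. (1 - fps_X ^ (5 * i + 1)) * (1 - fps_X ^ (5 * i + 4)))) (1 :: 'a::idom fps)"
proof -
  let ?S = "(\<Sum>s\<le>N. fps_X ^ (s\<^sup>2) * fps_inv_qpoch fps_X s) :: 'a fps"
  let ?R = "(\<Prod>i<N. (1 - fps_X ^ (5 * i + 1)) * (1 - fps_X ^ (5 * i + 4))) :: 'a fps"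
  let ?T = "fps_qpoch (fps_X ^ 5) N *
    (\<Prod>i<N. (1 - fps_X ^ 2 * (fps_X ^ 5) ^ i) * (1 - fps_X ^ 3 * (fps_X ^ 5) ^ i)) :: 'a fps"
  have dvd: "fps_X ^ k dvd X.theta_coeff 1 (fps_X :: 'a fps) k * fps_X ^ (2 * k\<^sup>2)" for k
    by (intro dvd_mult le_imp_power_dvd) (induction k, simp_all add: power2_eq_square)
  have "fps_cong N (fps_qpoch fps_X N * ?S)
      (\<Sum>k\<le>N. X.theta_coeff 1 (fps_X :: 'a fps) k * fps_X ^ (2 * k\<^sup>2))"
    by (rule X.rogers_ramanujan_theta_cong [OF dvd])
  also have "fps_cong N \<dots> ?T"
  proof (rule fps_cong_sym)
    have "fps_X ^ 2 * fps_X ^ 3 = (fps_X ^ 5 :: 'a fps)"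
      by (simp only: power_add [symmetric]) simp
    from X5.triple_product_cong [OF this, of N, unfolded theta_coeff_X5, OF dvd]
    show "fps_cong N ?T (\<Sum>k\<le>N. X.theta_coeff 1 (fps_X :: 'a fps) k * fps_X ^ (2 * k\<^sup>2))" .
  qed
  finally have "fps_cong N (fps_qpoch fps_X N * ?S * ?R) (?T * ?R)"
    by (rule fps_cong_mult_right)
  also have "?T * ?R = fps_qpoch fps_X (5 * N)"
    by (rule fps_qpoch_X5)
  also have "fps_cong N \<dots> (fps_qpoch fps_X N)"
    by (rule fps_cong_mono [OF X.qpoch_cong [of N]]) auto
  also have "fps_qpoch fps_X N * ?S * ?R = ?S * ?R * fps_qpoch fps_X N"
    by (simp only: mult_ac)
  finally have "fps_cong N (?S * ?R * fps_qpoch fps_X N) (1 * fps_qpoch fps_X N)"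
    by (simp only: mult_1)
  then show ?thesis
    by (rule fps_cong_cancel) simp
qed

section \<open>Convergence of q-adic sums and products\<close>

lemma fps_cong_LIMSEQ:
  assumes "\<And>n. fps_cong n (f n) L"
  shows "f \<longlonglongrightarrow> L"
proof (rule tendsto_fpsI)
  fix k
  show "eventually (\<lambda>n. fps_nth (f n) k = fps_nth L k) sequentially"
    using eventually_gt_at_top [of k]
    by eventually_elim (rule fps_cong_nth [OF assms])
qed

lemma fps_congI:
  assumes "\<And>k. k < n \<Longrightarrow> fps_nth f k = fps_nth g k"
  shows "fps_cong n f g"
proof -
  have "f - g = fps_X ^ n * fps_shift n (f - g)"
    by (rule fps_ext) (auto simp: fps_X_power_mult_nth assms)
  then show ?thesis unfolding fps_cong_def by (rule dvdI)
qed

lemma fps_prod_has_limit: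
  fixes f :: "nat \<Rightarrow> 'a::idom fps"
  assumes "\<And>k. fps_cong (Suc k) (f k) 1"
  shows "convergent_prod f \<and> (\<forall>n. fps_cong n (\<Prod>k<n. f k) (\<Prod>k. f k))"
proof -
  \<comment> \<open>The coefficient of order k no longer changes after the first k + 1 factors, so
    it can be read off there.\<close>
  define L where "L = Abs_fps (\<lambda>k. fps_nth (\<Prod>i<Suc k. f i) k)"
  have stable: "fps_cong n (\<Prod>i<n + d. f i) (\<Prod>i<n. f i)" for n d
  proof (induction d)
    case (Suc d)
    have "fps_cong n (f (n + d)) 1"
      by (rule fps_cong_mono [OF assms]) simp
    from fps_cong_mult [OF Suc this] show ?case by simp
  qed simp
  have L: "fps_cong n (\<Prod>i<n. f i) L" for n
  proof (rule fps_congI)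
    fix k assume "k < n"
    then have "n = Suc k + (n - Suc k)" by simp
    with fps_cong_nth [OF stable [of "Suc k" "n - Suc k"], of k]
    show "fps_nth (\<Prod>i<n. f i) k = fps_nth L k"
      by (simp add: L_def)
  qed
  have f0: "fps_nth (f k) 0 = 1" for k
    using fps_cong_nth [OF assms, of 0] by simp
  have "fps_nth L 0 = 1"
    by (simp add: L_def f0)
  \<comment> \<open>Convergence of an infinite product includes that the limit is nonzero; the
    constant term 1 ensures this.\<close>
  then have "L \<noteq> 0" by auto
  have "(\<lambda>n. \<Prod>i<n. f i) \<longlonglongrightarrow> L"
    by (rule fps_cong_LIMSEQ [OF L])
  then have "(\<lambda>n. \<Prod>i\<le>n. f i) \<longlonglongrightarrow> L"
    using LIMSEQ_Suc [of "\<lambda>n. \<Prod>i<n. f i" L] by (simp only: lessThan_Suc_atMost)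
  with \<open>L \<noteq> 0\<close> have *: "f has_prod L"
    by (simp add: has_prod_def raw_has_prod_def)
  then have "prodinf f = L"
    by (rule has_prod_unique [symmetric])
  moreover have "convergent_prod f"
    using * \<open>L \<noteq> 0\<close> by (auto simp: has_prod_def convergent_prod_def)
  ultimately show ?thesis using L by simp
qed

lemma fps_sums_of_cong:
  assumes "\<And>n. fps_cong n (\<Sum>k<n. f k) L"
  shows "f sums L"
  unfolding sums_def by (rule fps_cong_LIMSEQ [OF assms])

lemma fps_one_minus_X_power_nth_0 [simp]:
  "n > 0 \<Longrightarrow> fps_nth (1 - fps_X ^ n :: 'a::comm_ring_1 fps) 0 = 1"
  by (simp add: fps_nth_power_0 zero_power)

section \<open>Bringing the terms of the identity to Rogers-Ramanujan form\<close>

text \<open>Exactly the factors i = 1 and i = M of (q;q)_n are missing. The case M = 2 covers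
  products starting at i = 3.\<close>

lemma quot_prod_2_except:
  assumes "2 \<le> M" "M \<le> n"
  shows "1 \<oslash> (\<Prod>i\<in>{2..n} - {M}. 1 - fps_X ^ i) =
    (1 - fps_X) * (1 - fps_X ^ M) * (fps_inv_qpoch fps_X n :: 'a::idom fps)"
proof (rule fps_quot_unique [symmetric])
  let ?P = "\<Prod>i\<in>{2..n} - {M}. 1 - fps_X ^ i :: 'a fps"
  have "{1..n} = insert 1 (insert M ({2..n} - {M}))" using assms by auto
  then have "fps_qpoch fps_X n = (\<Prod>i\<in>insert 1 (insert M ({2..n} - {M})). 1 - fps_X ^ i :: 'a fps)"
    by (simp only: fps_qpoch_def)
  also have "\<dots> = (1 - fps_X) * (1 - fps_X ^ M) * ?P"
    using assms by (subst prod.insert; (subst prod.insert)?) (auto simp: mult.assoc)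
  finally have "fps_qpoch fps_X n = (1 - fps_X) * (1 - fps_X ^ M) * ?P" .
  then show "(1 - fps_X) * (1 - fps_X ^ M) * fps_inv_qpoch fps_X n * ?P = 1"
    using X.inv_qpoch_mult(1) [of n, where 'a = 'a] by (simp only: mult_ac)
  show "fps_nth ?P 0 = 1"
    by (auto simp: fps_nth_prod_0 intro!: prod.neutral)
qed

lemma quot_prod_3:
  assumes "2 \<le> n"
  shows "1 \<oslash> (\<Prod>i=3..n. 1 - fps_X ^ i) =
    (1 - fps_X) * (1 - fps_X ^ 2) * (fps_inv_qpoch fps_X n :: 'a::idom fps)"
proof -
  have "{3..n} = {2..n} - {2}" by auto
  then show ?thesis using quot_prod_2_except [of 2 n] assms by simp
qed

lemma qbracket_mult: "(1 - x) * qbracket n x = 1 - x ^ n"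
  by (simp add: qbracket_def one_diff_power_eq)

text \<open>The factor of index 0 of the Rogers-Ramanujan product is (1 - q)(1 - q^4). Splitting it
  off leaves the product from index 1 on, as in the theorem; 1 - q stays with the sum and 1 - q^4 is
  inverted.\<close>

lemma rogers_ramanujan_reduced_cong:
  "fps_cong N ((1 - fps_X) * (\<Sum>s\<le>Suc N. fps_X ^ (s\<^sup>2) * fps_inv_qpoch fps_X s))
    ((1 \<oslash> (1 - fps_X ^ 4)) *
      (\<Prod>k<N. 1 \<oslash> ((1 - fps_X ^ (5 * Suc k + 1)) * (1 - fps_X ^ (5 * Suc k + 4)))) :: 'a::idom fps)"
    (is "fps_cong N ((1 - fps_X) * ?S) (?r * ?P)")
proof -
  define R where "R k = (1 - fps_X ^ (5 * k + 1)) * (1 - fps_X ^ (5 * k + 4) :: 'a fps)" for k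
  have R0: "fps_nth (R k) 0 = 1" for k
    by (simp add: R_def del: power_Suc)
  have "(1 - fps_X ^ 4) * ?r = 1"
    by simp
  moreover have "(\<Prod>k<N. R (Suc k)) * ?P = 1"
    unfolding R_def [symmetric] by (simp add: R0 flip: prod.distrib)
  ultimately have cancel: "((1 - fps_X ^ 4) * ?r) * ((\<Prod>k<N. R (Suc k)) * ?P) = 1"
    by (simp only: mult_1)
  have "fps_cong (Suc N) (?S * (\<Prod>k<Suc N. R k)) 1"
    unfolding R_def by (rule rogers_ramanujan_cong)
  also have "(\<Prod>k<Suc N. R k) = (1 - fps_X) * (1 - fps_X ^ 4) * (\<Prod>k<N. R (Suc k))"
    by (simp only: prod.lessThan_Suc_shift) (simp add: R_def)
  finally have "fps_cong N (?S * ((1 - fps_X) * (1 - fps_X ^ 4) * (\<Prod>k<N. R (Suc k)))) 1"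
    by (rule fps_cong_mono) simp
  then have "fps_cong N (?S * ((1 - fps_X) * (1 - fps_X ^ 4) * (\<Prod>k<N. R (Suc k))) * (?r * ?P))
      (1 * (?r * ?P))"
    by (rule fps_cong_mult_right)
  also have "?S * ((1 - fps_X) * (1 - fps_X ^ 4) * (\<Prod>k<N. R (Suc k))) * (?r * ?P) =
      (1 - fps_X) * ?S * (((1 - fps_X ^ 4) * ?r) * ((\<Prod>k<N. R (Suc k)) * ?P))"
    by (simp only: mult_ac)
  finally show ?thesis
    by (simp only: cancel mult_1 mult_1_right)
qed

section \<open>The identity with t and w\<close>

theorem proposition5:
  fixes M :: nat
  assumes "M \<ge> 4" and "even M" and "M mod 5 = 1 \<or> M mod 5 = 4"
  shows
    "summable (\<lambda>k. qvar ^ ((M + k)\<^sup>2) \<oslash>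
        ((1 - tvar * qvar) * (1 - wvar * qvar ^ M) * (\<Prod>i\<in>{2..M + k} - {M}. 1 - qvar ^ i)))
     \<and> convergent_prod (\<lambda>k. 1 \<oslash>
        ((1 - qvar ^ (5 * Suc k + 1)) * (1 - qvar ^ (5 * Suc k + 4))))
     \<and> 1 + qvar * (tvar \<oslash> (1 - tvar * qvar))
       + (qvar ^ 4 \<oslash> (1 - tvar * qvar))
         * ((qbracket (M div 2) (qvar\<^sup>2) + (wvar - 1) * qvar ^ (M - 4)) \<oslash> (1 - wvar * qvar ^ M))
       + (\<Sum>k=3..M - 1.
           (qvar ^ (k\<^sup>2) \<oslash> ((1 - tvar * qvar) * (\<Prod>i=3..k. 1 - qvar ^ i)))
           * (qbracket (M div 2) (qvar\<^sup>2) \<oslash> (1 - wvar * qvar ^ M)))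
       + (\<Sum>k. qvar ^ ((M + k)\<^sup>2) \<oslash>
           ((1 - tvar * qvar) * (1 - wvar * qvar ^ M) * (\<Prod>i\<in>{2..M + k} - {M}. 1 - qvar ^ i)))
       = ((1 - qvar ^ M) \<oslash> (1 - wvar * qvar ^ M))
         * (1 \<oslash> ((1 - tvar * qvar) * (1 - qvar ^ 4)))
         * (\<Prod>k. 1 \<oslash> ((1 - qvar ^ (5 * Suc k + 1)) * (1 - qvar ^ (5 * Suc k + 4))))"
proof -
  define a b where "a = 1 \<oslash> (1 - tvar * qvar)" and "b = 1 \<oslash> (1 - wvar * qvar ^ M)"
  \<comment> \<open>The two factors missing from the denominators of the infinite sum: every term
    with k at least 3 becomes \<open>a * b * c\<close> times a Rogers-Ramanujan term.\<close>
  define c where "c = (1 - qvar) * (1 - qvar ^ M)"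
  define B where "B = qbracket (M div 2) (qvar\<^sup>2)"
  define I where "I = (fps_inv_qpoch fps_X :: nat \<Rightarrow> int poly poly fps)"
  define f where "f k = qvar ^ ((M + k)\<^sup>2) \<oslash>
    ((1 - tvar * qvar) * (1 - wvar * qvar ^ M) * (\<Prod>i\<in>{2..M + k} - {M}. 1 - qvar ^ i))" for k
  define g where "g k = 1 \<oslash> ((1 - qvar ^ (5 * Suc k + 1)) * (1 - qvar ^ (5 * Suc k + 4)))" for k
  define h where "h k = (qvar ^ (k\<^sup>2) \<oslash> ((1 - tvar * qvar) * (\<Prod>i=3..k. 1 - qvar ^ i)))
    * (B \<oslash> (1 - wvar * qvar ^ M))" for k
  define A where "A = 1 + qvar * (tvar \<oslash> (1 - tvar * qvar))
    + (qvar ^ 4 \<oslash> (1 - tvar * qvar)) * ((B + (wvar - 1) * qvar ^ (M - 4)) \<oslash> (1 - wvar * qvar ^ M))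
    + (\<Sum>k=3..M - 1. h k)"
  define r where "r = 1 \<oslash> (1 - qvar ^ 4)"
  define S where "S n = (\<Sum>s\<le>n. qvar ^ (s\<^sup>2) * I s)" for n
  have nth0: "fps_nth (1 - tvar * qvar) 0 = 1" "fps_nth (1 - wvar * qvar ^ M) 0 = 1"
    using assms(1) by (simp_all add: fps_nth_power_0)
  have nth0': "fps_nth (\<Prod>i\<in>T. 1 - qvar ^ i) 0 = 1" if "0 \<notin> T" for T
  proof -
    have "fps_nth (1 - qvar ^ i) 0 = 1" if "i \<in> T" for i
      using that \<open>0 \<notin> T\<close> by (cases i) (simp_all del: power_Suc)
    then show ?thesis by (simp only: fps_nth_prod_0 prod.neutral_const cong: prod.cong)
  qed
  have ab: "a * (1 - tvar * qvar) = 1" "b * (1 - wvar * qvar ^ M) = 1"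
    unfolding a_def b_def by (rule fps_quot_one_mult [OF nth0(1)], rule fps_quot_one_mult [OF nth0(2)])
  have B: "(1 - qvar\<^sup>2) * B = 1 - qvar ^ M"
    using assms(2) by (simp add: B_def qbracket_mult flip: power_mult)
  have f: "f k = a * b * c * (qvar ^ ((M + k)\<^sup>2) * I (M + k))" for k
  proof -
    have "f k = qvar ^ ((M + k)\<^sup>2) * (a * b * (1 \<oslash> (\<Prod>i\<in>{2..M + k} - {M}. 1 - qvar ^ i)))"
    proof -
      let ?P = "\<Prod>i\<in>{2..M + k} - {M}. 1 - qvar ^ i"
      have "1 \<oslash> ((1 - tvar * qvar) * (1 - wvar * qvar ^ M) * ?P) = a * b * (1 \<oslash> ?P)"
        unfolding a_def b_def
        unfolding fps_quot_one_mult_distrib [OF nth0, symmetric]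
        by (rule fps_quot_one_mult_distrib) (simp_all add: fps_mult_nth_0 nth0 nth0' del: fps_sub_nth)
      then show ?thesis
        unfolding f_def by (subst fps_quot_conv_mult) (simp only:)
    qed
    also have "1 \<oslash> (\<Prod>i\<in>{2..M + k} - {M}. 1 - qvar ^ i) = c * I (M + k)"
      unfolding c_def I_def using assms(1) by (intro quot_prod_2_except) auto
    finally show ?thesis by (simp only: mult_ac)
  qed
  have h: "h k = a * b * c * (qvar ^ (k\<^sup>2) * I k)" if "k \<ge> 3" for k
  proof -
    have "h k = qvar ^ (k\<^sup>2) * (a * (1 \<oslash> (\<Prod>i=3..k. 1 - qvar ^ i))) * (B * b)"
    proof -
      let ?P = "\<Prod>i=3..k. 1 - qvar ^ i"
      have "fps_nth ?P 0 = 1" by (rule nth0') simp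
      from fps_quot_one_mult_distrib [OF nth0(1) this] show ?thesis
        unfolding h_def fps_quot_conv_mult [of B] fps_quot_conv_mult [of "qvar ^ (k\<^sup>2)"]
        by (simp only: a_def b_def)
    qed
    also have "1 \<oslash> (\<Prod>i=3..k. 1 - qvar ^ i) = (1 - qvar) * (1 - qvar\<^sup>2) * I k"
      unfolding I_def using that by (intro quot_prod_3) auto
    \<comment> \<open>The factor 1 - q^2, present because the product starts at i = 3, is moved to
      \<open>B\<close> and turns it into 1 - q^M.\<close>
    also have "qvar ^ (k\<^sup>2) * (a * ((1 - qvar) * (1 - qvar\<^sup>2) * I k)) * (B * b) =
        qvar ^ (k\<^sup>2) * (a * ((1 - qvar) * I k)) * b * ((1 - qvar\<^sup>2) * B)"
      by (simp only: mult_ac)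
    finally show ?thesis unfolding B c_def by (simp only: mult_ac)
  qed
  \<comment> \<open>The terms 1 and q/(1 - q) add up to 1/(1 - q); in the third, (1 - q^M)/(1 - q^2)
    is \<open>B\<close>.\<close>
  have S2: "c * S 2 = (1 - qvar ^ M) + qvar ^ 4 * B"
  proof -
    have 1: "(1 - qvar) * I 1 = 1"
      using X.inv_qpoch_Suc [of 0, where 'a = "int poly poly"] by (simp add: I_def)
    have 2: "(1 - qvar\<^sup>2) * I 2 = I 1"
      using X.inv_qpoch_Suc [of 1, where 'a = "int poly poly"] by (simp add: I_def numeral_2_eq_2)
    have "c * S 2 = (1 - qvar) * (1 - qvar ^ M) * (1 + qvar * I 1 + qvar ^ 4 * I 2)"
      by (simp add: S_def c_def numeral_2_eq_2 I_def) (simp add: eval_nat_numeral)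
    also have "\<dots> = (1 - qvar ^ M) * (1 - qvar + qvar * ((1 - qvar) * I 1)) +
        qvar ^ 4 * (1 - qvar) * I 2 * (1 - qvar ^ M)"
      by (simp add: algebra_simps)
    also have "qvar ^ 4 * (1 - qvar) * I 2 * (1 - qvar ^ M) =
        qvar ^ 4 * ((1 - qvar) * ((1 - qvar\<^sup>2) * I 2)) * B"
      by (simp only: B [symmetric] mult_ac)
    finally show ?thesis unfolding 2 1 by simp
  qed
  have A: "A = a * b * c * S (M - 1)"
  proof -
    \<comment> \<open>Here t disappears: 1 + tq/(1 - tq) = 1/(1 - tq).\<close>
    have "1 + qvar * (tvar * a) = a * (1 - tvar * qvar) + qvar * (tvar * a)"
      by (simp only: ab)
    also have "\<dots> = a" by (simp add: algebra_simps)
    also have "\<dots> = a * (b * (1 - wvar * qvar ^ M))" by (simp only: ab mult_1_right)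
    finally have "1 + qvar * (tvar * a) + qvar ^ 4 * a * ((B + (wvar - 1) * qvar ^ (M - 4)) * b) =
        a * b * (1 - wvar * qvar ^ M + qvar ^ 4 * B + (wvar - 1) * (qvar ^ 4 * qvar ^ (M - 4)))"
      by (simp add: algebra_simps)
    also have "qvar ^ 4 * qvar ^ (M - 4) = qvar ^ M"
      using assms(1) by (simp flip: power_add)
    \<comment> \<open>Here w disappears: -w q^M + (w - 1) q^M = -q^M, and what remains is
      \<open>c * S 2\<close>.\<close>
    also have "a * b * (1 - wvar * qvar ^ M + qvar ^ 4 * B + (wvar - 1) * qvar ^ M) = a * b * c * S 2"
      unfolding mult.assoc [of "a * b" c] S2 by (simp add: algebra_simps)
    finally have "A = a * b * c * S 2 + (\<Sum>k=3..M - 1. h k)"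
      unfolding A_def a_def b_def by (simp only: fps_quot_conv_mult [of tvar]
        fps_quot_conv_mult [of "qvar ^ 4"] fps_quot_conv_mult [of "B + (wvar - 1) * qvar ^ (M - 4)"])
    also have "(\<Sum>k=3..M - 1. h k) = a * b * c * (\<Sum>k=3..M - 1. qvar ^ (k\<^sup>2) * I k)"
      by (simp add: h sum_distrib_left)
    also have "a * b * c * S 2 + \<dots> = a * b * c * (S 2 + (\<Sum>k=3..M - 1. qvar ^ (k\<^sup>2) * I k))"
      by (simp only: distrib_left)
    also have "S 2 + (\<Sum>k=3..M - 1. qvar ^ (k\<^sup>2) * I k) = S (M - 1)"
      unfolding S_def using assms(1)
      by (subst sum.union_disjoint [symmetric]) (auto intro!: sum.cong)
    finally show ?thesis .
  qed
  have partial: "A + (\<Sum>k<n. f k) = a * b * c * S (M - 1 + n)" for n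
  proof (induction n)
    case (Suc n)
    have M: "Suc (M - 1 + n) = M + n" using assms(1) by auto
    have "S (M - 1 + Suc n) = S (M - 1 + n) + qvar ^ ((M + n)\<^sup>2) * I (M + n)"
      unfolding M [symmetric] by (simp add: S_def)
    then show ?case using Suc by (simp add: f algebra_simps)
  qed (simp add: A)
  have "fps_cong (Suc k) (g k) 1" for k
  proof -
    have "fps_cong (Suc k) (1 - qvar ^ m) 1" if "m \<ge> Suc k" for m
      unfolding fps_cong_def using that by (simp add: dvd_minus_iff le_imp_power_dvd del: power_Suc)
    then have "fps_cong (Suc k) ((1 - qvar ^ (5 * Suc k + 1)) * (1 - qvar ^ (5 * Suc k + 4))) (1 * 1)"
      by (intro fps_cong_mult) auto
    moreover have "fps_nth ((1 - qvar ^ (5 * Suc k + 1)) * (1 - qvar ^ (5 * Suc k + 4))) 0 = 1"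
      by (simp only: fps_mult_nth_0 fps_one_minus_X_power_nth_0 add_gr_0 zero_less_numeral
        zero_less_one simp_thms mult_1)
    ultimately have "fps_cong (Suc k) (g k) (1 \<oslash> 1)"
      unfolding g_def mult_1 by (rule fps_cong_quot) simp
    then show ?thesis by (simp only: fps_quot_one_one)
  qed
  from fps_prod_has_limit [of g, OF this]
  have g: "convergent_prod g" "\<And>n. fps_cong n (\<Prod>k<n. g k) (\<Prod>k. g k)" by auto
  define R where "R = ((1 - qvar ^ M) \<oslash> (1 - wvar * qvar ^ M))
    * (1 \<oslash> ((1 - tvar * qvar) * (1 - qvar ^ 4))) * (\<Prod>k. g k)"
  have R: "R = a * b * (1 - qvar ^ M) * (r * (\<Prod>k. g k))"
    unfolding R_def a_def b_def r_def
    unfolding fps_quot_conv_mult [of "1 - qvar ^ M"]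
      fps_quot_one_mult_distrib [OF nth0(1) fps_one_minus_X_power_nth_0 [OF zero_less_numeral]]
    by (simp only: mult_ac)
  have "fps_cong n (A + (\<Sum>k<n. f k)) R" for n
  proof -
    \<comment> \<open>Chosen so that \<open>Suc ?N\<close> is the last summation index M - 1 + n;
      since \<open>?N\<close> is at least n, the congruence can be weakened to order n.\<close>
    let ?N = "M - 2 + n"
    have "M - 1 + n = Suc ?N" using assms(1) by simp
    then have "A + (\<Sum>k<n. f k) = a * b * (1 - qvar ^ M) * ((1 - qvar) * S (Suc ?N))"
      unfolding partial c_def by (simp only: mult_ac)
    also have "fps_cong ?N \<dots> (a * b * (1 - qvar ^ M) * (r * (\<Prod>k<?N. g k)))"
      unfolding S_def I_def r_def g_def by (intro fps_cong_mult_left rogers_ramanujan_reduced_cong)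
    also have "fps_cong ?N \<dots> R"
      unfolding R by (intro fps_cong_mult_left g)
    finally show ?thesis by (rule fps_cong_mono) simp
  qed
  \<comment> \<open>With the finite part \<open>A\<close> moved to the right, the congruences give
    both the summability and the value of the infinite sum.\<close>
  then have "fps_cong n (\<Sum>k<n. f k) (R - A)" for n
    unfolding fps_cong_def by (simp add: algebra_simps)
  then have sums: "f sums (R - A)"
    by (rule fps_sums_of_cong)
  have "summable f \<and> convergent_prod g \<and> A + (\<Sum>k. f k) = R"
    using sums_summable [OF sums] g(1) by (simp add: sums_unique [OF sums, symmetric])
  then show ?thesis
    unfolding A_def R_def f_def g_def h_def B_def .
qed

end
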